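(* Let $\Omega$ be an infinite set, $\{K_\theta\}_{\theta\in\Theta}$ a family of symmetric positive-definite kernels on $\Omega$, and $\{x_i\}_{i=1}^\infty$ a sequence of pairwise distinct points in $\Omega$. Let $\Sigma\subset\Theta$ and suppose that $B$ is a bounded subset of $H(K_{\theta_B})$ for some $\theta_B\in\Theta$. (1) If $$\limsup_{n\to\infty}\mathbb V_{\theta_B}(x_n\mid X_{n-1})<1\quad\text{and}\quad\liminf_{n\to\infty}\inf_{\theta\in\Sigma}\inf_{f_0\in B}\ell_{\mathrm{ML}}^{f_0}(\theta\mid X_n)>-\infty,$$ then there is $N\in\mathbb{N}$ such that $\hat\theta_{\mathrm{ML}}^{f_0}(X_n)\notin\Sigma$ for every $f_0\in B$ and every $n\ge N$. (2) Let $b=\sup_{f_0\in B}\|f_0\|_{\theta_B}$. If $$\limsup_{n\to\infty}\max_{1\le i\le n}\mathbb V_{\theta_B}(x_i\mid X_n^i)<\exp(-b^2)\quad\text{and}\quad\liminf_{n\to\infty}\inf_{\theta\in\Sigma}\inf_{f_0\in B}\ell_{\mathrm{CV}}^{f_0}(\theta\mid X_n)>-\infty,$$ then there is $N\in\mathbb{N}$ such that $\hat\theta_{\mathrm{CV}}^{f_0}(X_n)\notin\Sigma$ for every $f_0\in B$ and every $n\ge N$.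
   Context: A kernel $K_\theta:\Omega\times\Omega\to\mathbb{R}$ is symmetric and positive-definite in the strict sense: $\sum_{i,j=1}^na_ia_jK_\theta(x_i,x_j)>0$ for all $n\in\mathbb{N}$, pairwise distinct $x_1,\dots,x_n\in\Omega$ and non-zero $(a_1,\dots,a_n)\in\mathbb{R}^n$. $H(K_\theta)$ is its reproducing kernel Hilbert space with norm $\|\cdot\|_\theta$. Notation: $X_n=\{x_i\}_{i=1}^n$, $X_0=\emptyset$, $X_n^i=X_n\setminus\{x_i\}$. For a finite set $X$ of distinct points, $f_0(X)$ is the column vector of values of $f_0$ at the points of $X$, $K_\theta(X)$ is the matrix with entries $K_\theta(x_i,x_j)$, and $K_\theta(x,X)$ the column vector with entries $K_\theta(x,x_i)$. The conditional mean and variance are $$\mu_{\theta,f_0}(x\mid X)=K_\theta(x,X)^{\mathsf T}K_\theta(X)^{-1}f_0(X),\qquad \mathbb V_\theta(x\mid X)=K_\theta(x,x)-K_\theta(x,X)^{\mathsf T}K_\theta(X)^{-1}K_\theta(x,X),$$ with $\mu_{\theta,f_0}(x\mid\emptyset)=0$ and $\mathbb V_\theta(x\mid\emptyset)=K_\theta(x,x)$. Estimators: $\hat\theta_{\mathrm{ML}}^{f_0}(X_n)$ is any minimiser over $\theta\in\Theta$ of $$\ell_{\mathrm{ML}}^{f_0}(\theta\mid X_n)=f_0(X_n)^{\mathsf T}K_\theta(X_n)^{-1}f_0(X_n)+\log\det K_\theta(X_n),$$ and $\hat\theta_{\mathrm{CV}}^{f_0}(X_n)$ is any minimiser over $\theta\in\Theta$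 of $$\ell_{\mathrm{CV}}^{f_0}(\theta\mid X_n)=\sum_{i=1}^n\Big[\frac{(f_0(x_i)-\mu_{\theta,f_0}(x_i\mid X_n^i))^2}{\mathbb V_\theta(x_i\mid X_n^i)}+\log\mathbb V_\theta(x_i\mid X_n^i)\Big].$$ Minimisers are assumed to exist; results hold for an arbitrary choice of minimisers. *)

theory Defs
  imports
    Complex_Main
    "HOL-Library.FuncSet"
    "HOL-Library.Extended_Real"
    "HOL-Library.Liminf_Limsup"
    "Jordan_Normal_Form.Determinant"
    "Jordan_Normal_Form.Gauss_Jordan_Elimination"
begin

section \<open>Strictly positive-definite kernels\<close>

definition spd_kernel :: "'a set \<Rightarrow> ('a \<Rightarrow> 'a \<Rightarrow> real) \<Rightarrow> bool" where
  "spd_kernel Omega K \<longleftrightarrow>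
     (\<forall>x\<in>Omega. \<forall>y\<in>Omega. K x y = K y x) \<and>
     (\<forall>n (x :: nat \<Rightarrow> 'a) (a :: nat \<Rightarrow> real).
        x ` {1..n} \<subseteq> Omega \<longrightarrow> inj_on x {1..n} \<longrightarrow> (\<exists>i\<in>{1..n}. a i \<noteq> 0) \<longrightarrow>
        0 < (\<Sum>i=1..n. \<Sum>j=1..n. a i * a j * K (x i) (x j)))"

section \<open>Reproducing kernel Hilbert spaces\<close>

text \<open>
  Real functions on \<open>Omega\<close> are represented by elements of \<^term>\<open>extensional Omega\<close>, so that
  equality in HOL is equality on \<open>Omega\<close>; this is why the vector space operations are restricted
  to \<open>Omega\<close>.  Nothing is assumed about \<open>ip\<close> outside \<open>H\<close>.
\<close>

definition fun_norm :: "(('a \<Rightarrow> real) \<Rightarrow> ('a \<Rightarrow> real) \<Rightarrow> real) \<Rightarrow> ('a \<Rightarrow> real) \<Rightarrow> real" where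
  "fun_norm ip f = sqrt (ip f f)"

locale fun_hilbert_space =
  fixes Omega :: "'a set"
    and H :: "('a \<Rightarrow> real) set"
    and ip :: "('a \<Rightarrow> real) \<Rightarrow> ('a \<Rightarrow> real) \<Rightarrow> real"
  assumes extensional: "H \<subseteq> extensional Omega"
    and zero_mem: "(\<lambda>x\<in>Omega. 0) \<in> H"
    and add_mem: "f \<in> H \<Longrightarrow> g \<in> H \<Longrightarrow> (\<lambda>x\<in>Omega. f x + g x) \<in> H"
    and scale_mem: "f \<in> H \<Longrightarrow> (\<lambda>x\<in>Omega. c * f x) \<in> H"
    and ip_sym: "f \<in> H \<Longrightarrow> g \<in> H \<Longrightarrow> ip f g = ip g f"
    and ip_add: "f \<in> H \<Longrightarrow> g \<in> H \<Longrightarrow> h \<in> H \<Longrightarrow>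
                   ip (\<lambda>x\<in>Omega. f x + g x) h = ip f h + ip g h"
    and ip_scale: "f \<in> H \<Longrightarrow> h \<in> H \<Longrightarrow> ip (\<lambda>x\<in>Omega. c * f x) h = c * ip f h"
    and ip_pos: "f \<in> H \<Longrightarrow> f \<noteq> (\<lambda>x\<in>Omega. 0) \<Longrightarrow> 0 < ip f f"
    and complete:
      "(\<And>n :: nat. s n \<in> H) \<Longrightarrow>
       (\<And>e :: real. 0 < e \<Longrightarrow>
          \<exists>M. \<forall>m\<ge>M. \<forall>n\<ge>M. fun_norm ip (\<lambda>x\<in>Omega. s m x - s n x) < e) \<Longrightarrow>
       \<exists>l\<in>H. (\<lambda>n. fun_norm ip (\<lambda>x\<in>Omega. s n x - l x)) \<longlonglongrightarrow> 0"

text \<open>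
  For a positive-definite \<open>K\<close> the pair of \<open>H\<close> and \<open>ip\<close> restricted to \<open>H\<close> exists and is determined
  uniquely (Moore--Aronszajn), so \<open>rkhs Omega K H ip\<close> says that \<open>H\<close> with inner product \<open>ip\<close> is
  the reproducing kernel Hilbert space of \<open>K\<close>.
\<close>

locale rkhs = fun_hilbert_space Omega H ip
  for Omega :: "'a set"
    and K :: "'a \<Rightarrow> 'a \<Rightarrow> real"
    and H :: "('a \<Rightarrow> real) set"
    and ip :: "('a \<Rightarrow> real) \<Rightarrow> ('a \<Rightarrow> real) \<Rightarrow> real" +
  assumes section_mem: "x \<in> Omega \<Longrightarrow> (\<lambda>y\<in>Omega. K y x) \<in> H"
    and reproducing: "f \<in> H \<Longrightarrow> x \<in> Omega \<Longrightarrow> ip f (\<lambda>y\<in>Omega. K y x) = f x"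

section \<open>Conditional mean and variance\<close>

text \<open>
  A finite set of distinct points is given by a list enumerating it; the quantities below do not
  depend on the order of the enumeration.
\<close>

definition fun_vec :: "('a \<Rightarrow> real) \<Rightarrow> 'a list \<Rightarrow> real vec" where
  "fun_vec f X = vec (length X) (\<lambda>i. f (X ! i))"

definition kernel_mat :: "('a \<Rightarrow> 'a \<Rightarrow> real) \<Rightarrow> 'a list \<Rightarrow> real mat" where
  "kernel_mat K X = mat (length X) (length X) (\<lambda>(i, j). K (X ! i) (X ! j))"

text \<open>
  \<^const>\<open>mat_inverse\<close> returns \<^const>\<open>None\<close> only on singular matrices; kernel matrices of
  strictly positive-definite kernels at distinct points are invertible.
\<close>

definition kernel_mat_inv :: "('a \<Rightarrow> 'a \<Rightarrow> real) \<Rightarrow> 'a list \<Rightarrow> real mat" where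
  "kernel_mat_inv K X = the (mat_inverse (kernel_mat K X))"

definition cond_mean :: "('a \<Rightarrow> 'a \<Rightarrow> real) \<Rightarrow> ('a \<Rightarrow> real) \<Rightarrow> 'a \<Rightarrow> 'a list \<Rightarrow> real" where
  "cond_mean K f x X = fun_vec (K x) X \<bullet> (kernel_mat_inv K X *\<^sub>v fun_vec f X)"

definition cond_var :: "('a \<Rightarrow> 'a \<Rightarrow> real) \<Rightarrow> 'a \<Rightarrow> 'a list \<Rightarrow> real" where
  "cond_var K x X = K x x - fun_vec (K x) X \<bullet> (kernel_mat_inv K X *\<^sub>v fun_vec (K x) X)"

lemma kernel_mat_inv_Nil: "kernel_mat_inv K [] \<in> carrier_mat 0 0"
proof -
  have A: "kernel_mat K [] \<in> carrier_mat 0 0"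
    by (simp add: kernel_mat_def)
  have "kernel_mat K [] * 1\<^sub>m 0 = 1\<^sub>m 0" "1\<^sub>m 0 * kernel_mat K [] = 1\<^sub>m 0"
    by (auto simp: kernel_mat_def)
  then have "kernel_mat K [] \<in> Units (ring_mat TYPE(real) 0 b)" for b :: unit
    using A by (auto simp: Units_def ring_mat_def intro!: bexI[of _ "1\<^sub>m 0"])
  then obtain B where "mat_inverse (kernel_mat K []) = Some B"
    using mat_inverse(1)[OF A, of "()"] by (cases "mat_inverse (kernel_mat K [])") auto
  with mat_inverse(2)[OF A this] show ?thesis
    by (simp add: kernel_mat_inv_def)
qed

lemma cond_mean_Nil [simp]: "cond_mean K f x [] = 0"
  using kernel_mat_inv_Nil[of K] by (auto simp: cond_mean_def scalar_prod_def)

lemma cond_var_Nil [simp]: "cond_var K x [] = K x x"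
  using kernel_mat_inv_Nil[of K] by (auto simp: cond_var_def scalar_prod_def)

section \<open>Point sets, objective functions and estimators\<close>

text \<open>The sequence of points is \<open>x 1, x 2, \<dots>\<close>; the value \<open>x 0\<close> is never used.\<close>

definition pts :: "(nat \<Rightarrow> 'a) \<Rightarrow> nat \<Rightarrow> 'a list" where
  "pts x n = map x [1..<Suc n]"

definition pts_del :: "(nat \<Rightarrow> 'a) \<Rightarrow> nat \<Rightarrow> nat \<Rightarrow> 'a list" where
  "pts_del x n i = removeAll (x i) (pts x n)"

definition ell_ML :: "('a \<Rightarrow> 'a \<Rightarrow> real) \<Rightarrow> ('a \<Rightarrow> real) \<Rightarrow> (nat \<Rightarrow> 'a) \<Rightarrow> nat \<Rightarrow> real" where
  "ell_ML K f x n =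
     fun_vec f (pts x n) \<bullet> (kernel_mat_inv K (pts x n) *\<^sub>v fun_vec f (pts x n))
     + ln (det (kernel_mat K (pts x n)))"

definition ell_CV :: "('a \<Rightarrow> 'a \<Rightarrow> real) \<Rightarrow> ('a \<Rightarrow> real) \<Rightarrow> (nat \<Rightarrow> 'a) \<Rightarrow> nat \<Rightarrow> real" where
  "ell_CV K f x n =
     (\<Sum>i=1..n. (f (x i) - cond_mean K f (x i) (pts_del x n i))\<^sup>2 / cond_var K (x i) (pts_del x n i)
              + ln (cond_var K (x i) (pts_del x n i)))"

definition is_ML_estimate ::
  "'p set \<Rightarrow> ('p \<Rightarrow> 'a \<Rightarrow> 'a \<Rightarrow> real) \<Rightarrow> ('a \<Rightarrow> real) \<Rightarrow> (nat \<Rightarrow> 'a) \<Rightarrow> nat \<Rightarrow> 'p \<Rightarrow> bool" where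
  "is_ML_estimate Theta K f x n = is_arg_min (\<lambda>\<theta>. ell_ML (K \<theta>) f x n) (\<lambda>\<theta>. \<theta> \<in> Theta)"

definition is_CV_estimate ::
  "'p set \<Rightarrow> ('p \<Rightarrow> 'a \<Rightarrow> 'a \<Rightarrow> real) \<Rightarrow> ('a \<Rightarrow> real) \<Rightarrow> (nat \<Rightarrow> 'a) \<Rightarrow> nat \<Rightarrow> 'p \<Rightarrow> bool" where
  "is_CV_estimate Theta K f x n = is_arg_min (\<lambda>\<theta>. ell_CV (K \<theta>) f x n) (\<lambda>\<theta>. \<theta> \<in> Theta)"

end

theory Submission
  imports Defs "HOL-Real_Asymp.Real_Asymp"
begin

text \<open>
  It suffices that the objective at \<open>\<theta>B\<close> tends to minus infinity uniformly over \<open>B\<close>, since on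
  \<open>Sigma\<close> it stays bounded below.  For maximum likelihood the data term is at most the squared RKHS
  norm of \<open>f\<close>, and the log-determinant telescopes, via Schur complements, into the sum of the
  logarithms of the sequential conditional variances, which are eventually below a constant less
  than \<open>1\<close>.  For cross-validation, the conditional residual of a kernel section represents the prediction error
  and has squared norm equal to the conditional variance, so Cauchy--Schwarz bounds each of the
  \<open>n\<close> summands by \<open>b\<^sup>2 + ln c\<close> for some \<open>c < exp (- b\<^sup>2)\<close>.
\<close>

section \<open>Kernel matrices\<close>

lemma kernel_mat_carrier [simp]: "kernel_mat K X \<in> carrier_mat (length X) (length X)"
  by (simp add: kernel_mat_def)

lemma fun_vec_carrier [simp]: "fun_vec f X \<in> carrier_vec (length X)"
  by (simp add: fun_vec_def)

lemma scalar_prod_fun_vec: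
  assumes "a \<in> carrier_vec (length X)"
  shows "fun_vec f X \<bullet> a = (\<Sum>i<length X. a $ i * f (X ! i))"
  using assms by (auto simp: scalar_prod_def fun_vec_def lessThan_atLeast0 mult.commute)

lemma kernel_mat_mult_vec:
  assumes "a \<in> carrier_vec (length X)"
  shows "kernel_mat K X *\<^sub>v a = fun_vec (\<lambda>y. \<Sum>j<length X. a $ j * K y (X ! j)) X"
  using assms
  by (intro eq_vecI)
    (auto simp: kernel_mat_def fun_vec_def scalar_prod_def lessThan_atLeast0 mult.commute)

section \<open>Invertibility and interpolation\<close>

lemma spd_kernel_list:
  assumes spd: "spd_kernel Omega K" and X: "set X \<subseteq> Omega" "distinct X"
    and a: "a \<in> carrier_vec (length X)" "a \<noteq> 0\<^sub>v (length X)"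
  shows "0 < (\<Sum>i<length X. \<Sum>j<length X. a $ i * a $ j * K (X ! i) (X ! j))"
proof -
  \<comment> \<open>\<open>spd_kernel\<close> numbers its points from 1 while list positions start
    at 0, hence the shift.\<close>
  let ?x = "\<lambda>i. X ! (i - 1)" and ?a = "\<lambda>i. a $ (i - 1)"
  have "?x ` {1..length X} \<subseteq> Omega" using X(1) by force
  moreover have "inj_on ?x {1..length X}"
    using X(2) by (auto simp: inj_on_def nth_eq_iff_index_eq)
  moreover have "\<exists>i\<in>{1..length X}. ?a i \<noteq> 0"
  proof -
    have "\<exists>i<length X. a $ i \<noteq> 0"
    proof (rule ccontr)
      assume "\<not> ?thesis"
      then have "a = 0\<^sub>v (length X)" using a(1) by (intro eq_vecI) auto
      with a(2) show False by simp
    qed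
    then obtain i where "i < length X" "a $ i \<noteq> 0" by blast
    then show ?thesis by (intro bexI[of _ "Suc i"]) auto
  qed
  ultimately have "0 < (\<Sum>i=1..length X. \<Sum>j=1..length X. ?a i * ?a j * K (?x i) (?x j))"
    by (intro spd[unfolded spd_kernel_def, THEN conjunct2, rule_format])
  then show ?thesis by (simp add: sum.atLeast1_atMost_eq)
qed

text \<open>A nonzero null vector would make the quadratic form vanish, against strict
  positivity.\<close>

lemma det_kernel_mat_nonzero:
  assumes "spd_kernel Omega K" "set X \<subseteq> Omega" "distinct X"
  shows "det (kernel_mat K X) \<noteq> 0"
proof
  assume "det (kernel_mat K X) = 0"
  then obtain a where a: "a \<in> carrier_vec (length X)" "a \<noteq> 0\<^sub>v (length X)"
    and 0: "kernel_mat K X *\<^sub>v a = 0\<^sub>v (length X)"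
    using det_0_iff_vec_prod_zero[OF kernel_mat_carrier] by blast
  have "(\<Sum>j<length X. a $ j * K (X ! i) (X ! j)) = 0" if "i < length X" for i
    using arg_cong[OF 0, of "\<lambda>v. v $ i"] that a(1) by (simp add: kernel_mat_mult_vec fun_vec_def)
  then have "(\<Sum>i<length X. a $ i * (\<Sum>j<length X. a $ j * K (X ! i) (X ! j))) = 0" by simp
  then show False
    using spd_kernel_list[OF assms a] by (simp add: sum_distrib_left mult.assoc)
qed

text \<open>Nonsingularity rules out \<open>None\<close>, which justifies \<open>the\<close> in the
  definition of the inverse.\<close>

lemma kernel_mat_inv:
  assumes "spd_kernel Omega K" "set X \<subseteq> Omega" "distinct X"
  shows "kernel_mat_inv K X \<in> carrier_mat (length X) (length X)"
    and "kernel_mat K X * kernel_mat_inv K X = 1\<^sub>m (length X)"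
proof -
  have "kernel_mat K X \<in> Units (ring_mat TYPE(real) (length X) ())"
    by (rule det_non_zero_imp_unit[OF kernel_mat_carrier det_kernel_mat_nonzero[OF assms]])
  then obtain B where "mat_inverse (kernel_mat K X) = Some B"
    using mat_inverse(1)[OF kernel_mat_carrier, of K X "()"] by fastforce
  with mat_inverse(2)[OF kernel_mat_carrier this]
  show "kernel_mat_inv K X \<in> carrier_mat (length X) (length X)"
    and "kernel_mat K X * kernel_mat_inv K X = 1\<^sub>m (length X)"
    by (auto simp: kernel_mat_inv_def)
qed

lemma kernel_mat_solve:
  assumes "spd_kernel Omega K" "set X \<subseteq> Omega" "distinct X"
    and v: "v \<in> carrier_vec (length X)"
  shows "kernel_mat_inv K X *\<^sub>v v \<in> carrier_vec (length X)"
    and "kernel_mat K X *\<^sub>v (kernel_mat_inv K X *\<^sub>v v) = v"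
proof -
  note inv = kernel_mat_inv[OF assms(1-3)]
  show "kernel_mat_inv K X *\<^sub>v v \<in> carrier_vec (length X)" using inv v by simp
  show "kernel_mat K X *\<^sub>v (kernel_mat_inv K X *\<^sub>v v) = v"
    using assoc_mult_mat_vec[OF kernel_mat_carrier inv(1) v, of K] inv(2) v by simp
qed

text \<open>Row \<open>i\<close> of the solved linear system: the inverse applied to the data gives
  the coefficients of the kernel interpolant of \<open>f\<close>.\<close>

lemma kernel_mat_interpolate:
  assumes "spd_kernel Omega K" "set X \<subseteq> Omega" "distinct X"
    and i: "i < length X"
  shows "(\<Sum>j<length X. (kernel_mat_inv K X *\<^sub>v fun_vec f X) $ j * K (X ! i) (X ! j)) = f (X ! i)"
  using arg_cong[OF kernel_mat_solve(2)[OF assms(1-3) fun_vec_carrier, of f], of "\<lambda>v. v $ i"]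
    kernel_mat_solve(1)[OF assms(1-3) fun_vec_carrier, of f] i
  by (simp add: kernel_mat_mult_vec fun_vec_def)

section \<open>Symmetry and the Schur complement\<close>

lemma transpose_kernel_mat:
  assumes "spd_kernel Omega K" "set X \<subseteq> Omega"
  shows "transpose_mat (kernel_mat K X) = kernel_mat K X"
  using assms by (intro eq_matI) (auto simp: kernel_mat_def spd_kernel_def subset_iff)

text \<open>Symmetry of the kernel matrix moves the inverse from the data to the kernel vector, so
  the weights on the values of \<open>f\<close> no longer depend on \<open>f\<close>.\<close>

lemma cond_mean_weights:
  assumes "spd_kernel Omega K" "set X \<subseteq> Omega" "distinct X"
  shows "cond_mean K f x X = fun_vec f X \<bullet> (kernel_mat_inv K X *\<^sub>v fun_vec (K x) X)"
proof -
  let ?w = "kernel_mat_inv K X *\<^sub>v fun_vec (K x) X" and ?a = "kernel_mat_inv K X *\<^sub>v fun_vec f X"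
  note solve = kernel_mat_solve[OF assms fun_vec_carrier]
  have "cond_mean K f x X = (kernel_mat K X *\<^sub>v ?w) \<bullet> ?a"
    by (simp add: cond_mean_def solve)
  also have "\<dots> = ?w \<bullet> (kernel_mat K X *\<^sub>v ?a)"
    using transpose_vec_mult_scalar[OF kernel_mat_carrier solve(1) solve(1), of K "K x" f]
    by (simp add: transpose_kernel_mat[OF assms(1,2)])
  also have "\<dots> = fun_vec f X \<bullet> ?w"
    by (simp add: solve comm_scalar_prod[OF solve(1) fun_vec_carrier])
  finally show ?thesis .
qed

text \<open>Multiplying by the unipotent block matrix with last column \<open>(-w, 1)\<close>, where \<open>w\<close> solves the
  linear system for the new column, clears that column up to the Schur complement.\<close>

lemma det_kernel_mat_snoc:
  assumes spd: "spd_kernel Omega K" and X: "set X \<subseteq> Omega" "distinct X" and x: "x \<in> Omega"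
  shows "det (kernel_mat K (X @ [x])) = det (kernel_mat K X) * cond_var K x X"
proof -
  define n where "n = length X"
  define A where "A = kernel_mat K X"
  define k where "k = fun_vec (K x) X"
  define w where "w = kernel_mat_inv K X *\<^sub>v k"
  define kc kr wc where "kc = mat n 1 (\<lambda>(i, _). k $ i)" and "kr = mat 1 n (\<lambda>(_, j). k $ j)"
    and "wc = mat n 1 (\<lambda>(i, _). - w $ i)"
  define c where "c = mat 1 1 (\<lambda>_. K x x)"
  have A: "A \<in> carrier_mat n n" and k: "k \<in> carrier_vec n" and w: "w \<in> carrier_vec n"
    and Aw: "A *\<^sub>v w = k"
    using kernel_mat_solve[OF spd X, of k] by (auto simp: A_def k_def w_def n_def)
  have car: "kc \<in> carrier_mat n 1" "kr \<in> carrier_mat 1 n" "wc \<in> carrier_mat n 1"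
    "c \<in> carrier_mat 1 1"
    by (auto simp: kc_def kr_def wc_def c_def)
  have big: "kernel_mat K (X @ [x]) = four_block_mat A kc kr c"
  proof (rule eq_matI)
    fix i j assume "i < dim_row (four_block_mat A kc kr c)" "j < dim_col (four_block_mat A kc kr c)"
    then have ij: "i < Suc n" "j < Suc n" using A car by auto
    have sym: "K (X ! l) x = K x (X ! l)" if "l < n" for l
      using spd X(1) x that unfolding spd_kernel_def n_def by (meson nth_mem subsetD)
    have "i < n \<or> i = n" "j < n \<or> j = n" using ij by auto
    then show "kernel_mat K (X @ [x]) $$ (i, j) = four_block_mat A kc kr c $$ (i, j)"
      by (elim disjE) (simp_all add: A_def kc_def kr_def c_def k_def kernel_mat_def fun_vec_def
          nth_append sym flip: n_def)
  qed (use A car in \<open>simp_all add: kernel_mat_def n_def\<close>)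
  let ?U = "four_block_mat (1\<^sub>m n) wc (0\<^sub>m 1 n) (1\<^sub>m 1)"
  \<comment> \<open>The upper right block of the product vanishes because \<open>w\<close> solves
    the system with right-hand side \<open>k\<close>.\<close>
  have "A * wc + kc = 0\<^sub>m n 1"
  proof (rule eq_matI)
    fix i j assume "i < dim_row (0\<^sub>m n 1)" "j < dim_col (0\<^sub>m n 1)"
    then have ij: "i < n" "j = 0" by auto
    have "(\<Sum>l<n. A $$ (i, l) * w $ l) = k $ i"
      using arg_cong[OF Aw, of "\<lambda>v. v $ i"] A w ij(1)
      by (auto simp: scalar_prod_def lessThan_atLeast0)
    moreover have "row A i \<bullet> col wc 0 = - (\<Sum>l<n. A $$ (i, l) * w $ l)"
      using A ij by (auto simp: scalar_prod_def lessThan_atLeast0 wc_def sum_negf)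
    ultimately show "(A * wc + kc) $$ (i, j) = 0\<^sub>m n 1 $$ (i, j)"
      using A car ij by (auto simp: kc_def)
  qed (use A car in auto)
  \<comment> \<open>The lower right block is the Schur complement of \<open>A\<close>, that is, the
    conditional variance.\<close>
  moreover have "kr * wc + c = mat 1 1 (\<lambda>_. cond_var K x X)"
  proof (rule eq_matI)
    fix i j
    assume "i < dim_row (mat 1 1 (\<lambda>_. cond_var K x X))" "j < dim_col (mat 1 1 (\<lambda>_. cond_var K x X))"
    then have ij: "i = 0" "j = 0" by auto
    have "row kr 0 \<bullet> col wc 0 = - (k \<bullet> w)"
      using w by (auto simp: scalar_prod_def kr_def wc_def sum_negf)
    then show "(kr * wc + c) $$ (i, j) = mat 1 1 (\<lambda>_. cond_var K x X) $$ (i, j)"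
      using car ij by (auto simp: c_def cond_var_def k_def w_def)
  qed (use car in auto)
  moreover have "four_block_mat A kc kr c * ?U =
      four_block_mat (A * 1\<^sub>m n + kc * 0\<^sub>m 1 n) (A * wc + kc * 1\<^sub>m 1)
        (kr * 1\<^sub>m n + c * 0\<^sub>m 1 n) (kr * wc + c * 1\<^sub>m 1)"
    using A car by (intro mult_four_block_mat) auto
  ultimately have "four_block_mat A kc kr c * ?U =
      four_block_mat A (0\<^sub>m n 1) kr (mat 1 1 (\<lambda>_. cond_var K x X))"
    using A car by simp
  then have "det (four_block_mat A kc kr c * ?U) =
      det A * det (mat 1 1 (\<lambda>_. cond_var K x X))"
    using A car by (simp add: det_four_block_mat_upper_right_zero_col[of _ n])
  moreover have "det ?U = 1"
    using car by (subst det_four_block_mat_lower_left_zero[of _ n _ 1]) auto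
  moreover have "det (four_block_mat A kc kr c * ?U) = det (four_block_mat A kc kr c) * det ?U"
    using A car by (intro det_mult[of _ "n + 1"]) auto
  ultimately show ?thesis
    by (simp add: big A_def det_single)
qed

section \<open>The reproducing kernel Hilbert space\<close>

context fun_hilbert_space
begin

section \<open>Inner-product inequalities\<close>

lemma diff_scale_mem:
  assumes "f \<in> H" "h \<in> H"
  shows "(\<lambda>x\<in>Omega. f x - c * h x) \<in> H"
proof -
  have "(\<lambda>x\<in>Omega. f x - c * h x) = (\<lambda>x\<in>Omega. f x + (\<lambda>x\<in>Omega. (- c) * h x) x)" by auto
  then show ?thesis using add_mem[OF assms(1) scale_mem[OF assms(2)]] by metis
qed

lemma ip_diff_scale:
  assumes "f \<in> H" "h \<in> H" "g \<in> H"
  shows "ip (\<lambda>x\<in>Omega. f x - c * h x) g = ip f g - c * ip h g"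
proof -
  have "(\<lambda>x\<in>Omega. f x - c * h x) = (\<lambda>x\<in>Omega. f x + (\<lambda>x\<in>Omega. (- c) * h x) x)" by auto
  then show ?thesis using assms by (simp only: ip_add scale_mem ip_scale)
qed

lemma ip_zero_left:
  assumes "h \<in> H"
  shows "ip (\<lambda>x\<in>Omega. 0) h = 0"
  using ip_scale[OF assms assms, of 0] by simp

lemma ip_nonneg: "f \<in> H \<Longrightarrow> 0 \<le> ip f f"
  using ip_pos[of f] ip_zero_left[OF zero_mem] by (cases "f = (\<lambda>x\<in>Omega. 0)") auto

text \<open>The expression is the squared norm of \<open>f - c h\<close>. The free coefficient
  serves Cauchy--Schwarz and, with \<open>c = 1\<close>, the projection bound.\<close>

lemma ip_residual:
  assumes "f \<in> H" "h \<in> H"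
  shows "0 \<le> ip f f - 2 * c * ip f h + c\<^sup>2 * ip h h"
proof -
  let ?r = "\<lambda>x\<in>Omega. f x - c * h x"
  note r = diff_scale_mem[OF assms, of c]
  have "ip ?r ?r = ip f ?r - c * ip h ?r" by (rule ip_diff_scale[OF assms r])
  also have "\<dots> = (ip f f - c * ip h f) - c * (ip f h - c * ip h h)"
    using assms by (simp only: ip_sym[OF _ r] ip_diff_scale)
  also have "\<dots> = ip f f - 2 * c * ip f h + c\<^sup>2 * ip h h"
    by (simp add: ip_sym[OF assms] power2_eq_square algebra_simps)
  finally show ?thesis using ip_nonneg[OF r] by simp
qed

lemma cauchy_schwarz:
  assumes "f \<in> H" "h \<in> H"
  shows "(ip f h)\<^sup>2 \<le> ip f f * ip h h"
proof (cases "h = (\<lambda>x\<in>Omega. 0)")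
  case True
  then show ?thesis
    using ip_zero_left[OF assms(1)] ip_zero_left[OF assms(2)] ip_sym[OF assms] by simp
next
  case False
  then have pos: "0 < ip h h" by (rule ip_pos[OF assms(2)])
  \<comment> \<open>The coefficient \<open>ip f h / ip h h\<close> minimises the squared norm of
    \<open>f - c h\<close>.\<close>
  then show ?thesis
    using ip_residual[OF assms, of "ip f h / ip h h"] by (simp add: field_simps power2_eq_square)
qed

end

context rkhs
begin

text \<open>Restriction to \<open>Omega\<close> keeps the combination extensional, as membership in
  \<open>H\<close> demands.\<close>

definition section_sum :: "'a list \<Rightarrow> real vec \<Rightarrow> 'a \<Rightarrow> real" where
  "section_sum X a = (\<lambda>y\<in>Omega. \<Sum>i<length X. a $ i * K y (X ! i))"

lemma section_sum:
  assumes X: "set X \<subseteq> Omega"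
  shows section_sum_mem: "section_sum X a \<in> H"
    and ip_section_sum: "f \<in> H \<Longrightarrow> ip f (section_sum X a) = (\<Sum>i<length X. a $ i * f (X ! i))"
proof -
  \<comment> \<open>Induction on the number of leading sections. Linearity of \<open>ip\<close>
    needs membership at each stage, hence the conjunction.\<close>
  have "(\<lambda>y\<in>Omega. \<Sum>i<m. a $ i * K y (X ! i)) \<in> H \<and>
      (\<forall>f\<in>H. ip f (\<lambda>y\<in>Omega. \<Sum>i<m. a $ i * K y (X ! i)) = (\<Sum>i<m. a $ i * f (X ! i)))"
    if "m \<le> length X" for m
    using that
  proof (induction m)
    case 0
    have "ip f (\<lambda>y\<in>Omega. 0) = 0" if "f \<in> H" for f
      using ip_zero_left[OF that] ip_sym[OF that zero_mem] by simp
    then show ?case using zero_mem by (simp only: lessThan_0 sum.empty) blast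
  next
    case (Suc m)
    let ?g = "\<lambda>y\<in>Omega. \<Sum>i<m. a $ i * K y (X ! i)" and ?k = "\<lambda>y\<in>Omega. K y (X ! m)"
    have p: "X ! m \<in> Omega" using Suc.prems X by (auto simp: subset_iff)
    have g: "?g \<in> H" and ip_g: "\<forall>f\<in>H. ip f ?g = (\<Sum>i<m. a $ i * f (X ! i))"
      using Suc.IH[OF Suc_leD[OF Suc.prems]] by blast+
    have k: "?k \<in> H" by (rule section_mem[OF p])
    \<comment> \<open>The new term is subtracted with negated coefficient, so that the rules for
      \<open>f - c h\<close> apply.\<close>
    have eq: "(\<lambda>y\<in>Omega. \<Sum>i<Suc m. a $ i * K y (X ! i)) = (\<lambda>y\<in>Omega. ?g y - (- a $ m) * ?k y)"
      by auto
    have "ip f (\<lambda>y\<in>Omega. ?g y - (- a $ m) * ?k y) = (\<Sum>i<Suc m. a $ i * f (X ! i))"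
      if f: "f \<in> H" for f
    proof -
      have "ip f (\<lambda>y\<in>Omega. ?g y - (- a $ m) * ?k y) = ip ?g f - (- a $ m) * ip ?k f"
        by (simp only: ip_sym[OF f diff_scale_mem[OF g k]] ip_diff_scale[OF g k f])
      also have "\<dots> = ip f ?g + a $ m * ip f ?k"
        by (simp only: ip_sym[OF g f] ip_sym[OF k f] mult_minus_left diff_minus_eq_add)
      finally show ?thesis by (simp only: bspec[OF ip_g f] reproducing[OF f p] sum.lessThan_Suc)
    qed
    then show ?case unfolding eq using diff_scale_mem[OF g k] by blast
  qed
  then show "section_sum X a \<in> H"
    and "f \<in> H \<Longrightarrow> ip f (section_sum X a) = (\<Sum>i<length X. a $ i * f (X ! i))"
    by (auto simp: section_sum_def)
qed

text \<open>The quadratic form is the squared norm of the interpolant, which is the orthogonal projection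
  of \<open>f\<close> onto the span of the kernel sections.\<close>

lemma quadratic_form_le_ip:
  assumes "spd_kernel Omega K" "set X \<subseteq> Omega" "distinct X" "f \<in> H"
  shows "fun_vec f X \<bullet> (kernel_mat_inv K X *\<^sub>v fun_vec f X) \<le> ip f f"
proof -
  let ?a = "kernel_mat_inv K X *\<^sub>v fun_vec f X"
  let ?g = "section_sum X ?a"
  note g = section_sum_mem[OF assms(2), of ?a]
  have val: "?g (X ! i) = f (X ! i)" if "i < length X" for i
  proof -
    have "X ! i \<in> Omega" using that assms(2) by (auto simp: subset_iff)
    then show ?thesis
      using kernel_mat_interpolate[OF assms(1-3) that] by (simp add: section_sum_def)
  qed
  have q: "fun_vec f X \<bullet> ?a = ip f ?g"
    by (simp add: scalar_prod_fun_vec kernel_mat_solve(1)[OF assms(1-3)] ip_section_sum assms)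
  \<comment> \<open>Pairing with \<open>?g\<close> only sees values at \<open>X\<close>, where
    \<open>?g\<close> agrees with \<open>f\<close>.\<close>
  moreover have "ip ?g ?g = ip f ?g"
    by (simp add: ip_section_sum assms g val)
  ultimately show ?thesis using ip_residual[OF assms(4) g, of 1] by simp
qed

text \<open>For distinct points, the kernel section at \<open>x\<close> minus its orthogonal
  projection onto the span of the sections at \<open>X\<close>. The factor \<open>1\<close> and the
  inner restriction match the form of \<open>diff_scale_mem\<close> and
  \<open>ip_diff_scale\<close>.\<close>

definition cond_residual :: "'a \<Rightarrow> 'a list \<Rightarrow> 'a \<Rightarrow> real" where
  "cond_residual x X = (\<lambda>y\<in>Omega. (\<lambda>y\<in>Omega. K y x) y
     - 1 * section_sum X (kernel_mat_inv K X *\<^sub>v fun_vec (K x) X) y)"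

lemma cond_residual_mem:
  assumes "set X \<subseteq> Omega" "x \<in> Omega"
  shows "cond_residual x X \<in> H"
  unfolding cond_residual_def by (intro diff_scale_mem section_mem section_sum_mem assms)

text \<open>The section at \<open>x\<close> reproduces \<open>f x\<close>, and the subtracted
  combination yields the weighted values of \<open>f\<close> that form the conditional mean.\<close>

lemma ip_cond_residual:
  assumes "spd_kernel Omega K" "set X \<subseteq> Omega" "distinct X" "x \<in> Omega" "f \<in> H"
  shows "ip f (cond_residual x X) = f x - cond_mean K f x X"
proof -
  let ?w = "kernel_mat_inv K X *\<^sub>v fun_vec (K x) X"
  note k = section_mem[OF assms(4)] and g = section_sum_mem[OF assms(2), of ?w]
  have "ip f (cond_residual x X) = ip (\<lambda>y\<in>Omega. K y x) f - 1 * ip (section_sum X ?w) f"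
    using ip_sym[OF assms(5) cond_residual_mem[OF assms(2,4)]] ip_diff_scale[OF k g assms(5)]
    by (simp only: cond_residual_def)
  also have "\<dots> = ip f (\<lambda>y\<in>Omega. K y x) - ip f (section_sum X ?w)"
    by (simp only: ip_sym[OF k assms(5)] ip_sym[OF g assms(5)] mult_1)
  also have "\<dots> = f x - cond_mean K f x X"
    by (simp add: reproducing ip_section_sum assms cond_mean_weights[OF assms(1-3)]
        scalar_prod_fun_vec kernel_mat_solve(1)[OF assms(1-3)])
  finally show ?thesis .
qed

lemma cond_residual_apply:
  assumes "spd_kernel Omega K" "set X \<subseteq> Omega" "distinct X" "x \<in> Omega"
  shows "cond_residual x X x = cond_var K x X"
  using assms by (simp add: cond_residual_def section_sum_def cond_var_def scalar_prod_fun_vec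
      kernel_mat_solve(1)[OF assms(1-3)])

text \<open>The projection interpolates \<open>K x\<close> on \<open>X\<close>, and there
  \<open>K x\<close> equals the section at \<open>x\<close> by symmetry.\<close>

lemma cond_residual_nth:
  assumes "spd_kernel Omega K" "set X \<subseteq> Omega" "distinct X" "x \<in> Omega" "i < length X"
  shows "cond_residual x X (X ! i) = 0"
proof -
  have "X ! i \<in> Omega" using assms by (auto simp: subset_iff)
  then show ?thesis
    using assms kernel_mat_interpolate[OF assms(1-3,5), of "K x"]
    by (simp add: cond_residual_def section_sum_def spd_kernel_def)
qed

text \<open>The residual vanishes on \<open>X\<close>, so its own conditional mean is zero and only
  its value at \<open>x\<close> remains.\<close>

lemma ip_cond_residual_self:
  assumes "spd_kernel Omega K" "set X \<subseteq> Omega" "distinct X" "x \<in> Omega"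
  shows "ip (cond_residual x X) (cond_residual x X) = cond_var K x X"
proof -
  have "cond_mean K (cond_residual x X) x X = 0"
    by (simp add: cond_mean_weights[OF assms(1-3)] scalar_prod_fun_vec
        kernel_mat_solve(1)[OF assms(1-3)] cond_residual_nth[OF assms])
  then show ?thesis
    using ip_cond_residual[OF assms cond_residual_mem[OF assms(2,4)]] cond_residual_apply[OF assms]
    by simp
qed

lemma sq_error_le:
  assumes "spd_kernel Omega K" "set X \<subseteq> Omega" "distinct X" "x \<in> Omega" "f \<in> H"
  shows "(f x - cond_mean K f x X)\<^sup>2 \<le> ip f f * cond_var K x X"
  using cauchy_schwarz[OF assms(5) cond_residual_mem[OF assms(2,4)]]
  by (simp add: ip_cond_residual[OF assms] ip_cond_residual_self[OF assms(1-4)])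

text \<open>As a squared norm the variance is nonnegative; nonsingularity of the matrix extended by
  \<open>x\<close> excludes zero.\<close>

lemma cond_var_pos:
  assumes "spd_kernel Omega K" "set X \<subseteq> Omega" "distinct X" "x \<in> Omega" "x \<notin> set X"
  shows "0 < cond_var K x X"
proof -
  have "det (kernel_mat K (X @ [x])) \<noteq> 0"
    using assms by (intro det_kernel_mat_nonzero[of Omega]) auto
  then have "cond_var K x X \<noteq> 0"
    using det_kernel_mat_snoc[OF assms(1-4)] by auto
  moreover have "0 \<le> cond_var K x X"
    using ip_nonneg[OF cond_residual_mem[OF assms(2,4)]] ip_cond_residual_self[OF assms(1-4)] by simp
  ultimately show ?thesis by simp
qed

end

section \<open>Upper bounds for the objective functions\<close>

lemma pts_props:
  assumes "x ` {1..} \<subseteq> Omega" "inj_on x {1..}"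
  shows "set (pts x n) \<subseteq> Omega" "distinct (pts x n)"
    and "x (Suc n) \<in> Omega" "x (Suc n) \<notin> set (pts x n)"
  using assms by (auto simp: pts_def distinct_map image_subset_iff
      dest: inj_onD[OF assms(2)] intro: inj_on_subset[OF assms(2)])

lemma pts_Suc: "pts x (Suc n) = pts x n @ [x (Suc n)]"
  by (simp add: pts_def)

lemma pts_del_props:
  assumes "x ` {1..} \<subseteq> Omega" "inj_on x {1..}"
  shows "set (pts_del x n i) \<subseteq> Omega" "distinct (pts_del x n i)" "x i \<notin> set (pts_del x n i)"
  using pts_props(1,2)[OF assms, of n] by (auto simp: pts_del_def distinct_removeAll)

context rkhs
begin

context
  fixes x :: "nat \<Rightarrow> 'a"
  assumes spd: "spd_kernel Omega K" and x: "x ` {1..} \<subseteq> Omega" "inj_on x {1..}"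
begin

lemma cond_var_pts_pos: "1 \<le> n \<Longrightarrow> 0 < cond_var K (x n) (pts x (n - 1))"
  using cond_var_pos[OF spd pts_props[OF x, of "n - 1"]] by simp

text \<open>Positivity is part of the induction so that the logarithm of each product
  splits.\<close>

lemma ln_det_kernel_mat_pts:
  "0 < det (kernel_mat K (pts x n)) \<and>
   ln (det (kernel_mat K (pts x n))) = (\<Sum>i=1..n. ln (cond_var K (x i) (pts x (i - 1))))"
proof (induction n)
  case 0
  show ?case by (simp add: pts_def kernel_mat_def)
next
  case (Suc n)
  then show ?case
    using cond_var_pts_pos[of "Suc n"]
    by (simp add: pts_Suc det_kernel_mat_snoc[OF spd pts_props(1-3)[OF x]] ln_mult)
qed

lemma ell_ML_le:
  assumes "f \<in> H"
  shows "ell_ML K f x n \<le> ip f f + (\<Sum>i=1..n. ln (cond_var K (x i) (pts x (i - 1))))"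
  using quadratic_form_le_ip[OF spd pts_props(1,2)[OF x] assms] ln_det_kernel_mat_pts[of n]
  by (simp add: ell_ML_def)

lemma cond_var_pts_del_pos: "1 \<le> i \<Longrightarrow> 0 < cond_var K (x i) (pts_del x n i)"
  using x(1) by (intro cond_var_pos[OF spd] pts_del_props[OF x]) auto

text \<open>The squared error is at most \<open>ip f f\<close> times the variance, so dividing by
  the positive variance leaves \<open>ip f f\<close>.\<close>

lemma ell_CV_le:
  assumes "f \<in> H"
  shows "ell_CV K f x n \<le> (\<Sum>i=1..n. ip f f + ln (cond_var K (x i) (pts_del x n i)))"
  unfolding ell_CV_def
proof (intro sum_mono add_right_mono)
  fix i assume i: "i \<in> {1..n}"
  then have "x i \<in> Omega" using x(1) by auto
  then show "(f (x i) - cond_mean K f (x i) (pts_del x n i))\<^sup>2 / cond_var K (x i) (pts_del x n i)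
      \<le> ip f f"
    using sq_error_le[OF spd pts_del_props(1,2)[OF x] _ assms, of "x i" n i]
      cond_var_pts_del_pos[of i n] i by (simp add: divide_le_eq)
qed

end

end

section \<open>Escape from the excluded parameter set\<close>

text \<open>A real fits strictly between the limsup and \<open>L\<close>; this fixed gap later makes
  the slope of the upper bound strictly negative.\<close>

lemma limsup_ereal_less_eventually:
  fixes X :: "nat \<Rightarrow> real"
  assumes "limsup (\<lambda>n. ereal (X n)) < ereal L"
  obtains c where "c < L" "\<forall>\<^sub>F n in sequentially. X n < c"
proof -
  obtain c where c: "limsup (\<lambda>n. ereal (X n)) < ereal c" "ereal c < ereal L"
    using ereal_dense2[OF assms] by blast
  from Limsup_lessD[OF c(1)] have "\<forall>\<^sub>F n in sequentially. X n < c" by simp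
  with c(2) show ?thesis by (intro that) auto
qed

lemma linear_at_bot:
  fixes d e :: real
  assumes "d < 0"
  shows "filterlim (\<lambda>n::nat. e + real n * d) at_bot sequentially"
  using assms by real_asymp

lemma sum_at_bot:
  fixes u :: "nat \<Rightarrow> real"
  assumes "d < 0" and "\<forall>\<^sub>F n in sequentially. u n \<le> d"
  shows "filterlim (\<lambda>n. e + (\<Sum>i=1..n. u i)) at_bot sequentially"
proof -
  obtain M where M: "\<And>n. M \<le> n \<Longrightarrow> u n \<le> d"
    using assms(2) by (auto simp: eventually_sequentially)
  \<comment> \<open>\<open>?C\<close> gives equality at \<open>n = M\<close> and absorbs the early
    terms, which \<open>d\<close> need not bound.\<close>
  let ?C = "(\<Sum>i=1..M. u i) - real M * d"
  have "(\<Sum>i=1..n. u i) \<le> ?C + real n * d" if "M \<le> n" for n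
    using that
  proof (induction n rule: dec_induct)
    case (step n)
    then show ?case using M[of "Suc n"] by (simp add: algebra_simps)
  qed simp
  then have "\<forall>\<^sub>F n in sequentially. e + (\<Sum>i=1..n. u i) \<le> (e + ?C) + real n * d"
    by (intro eventually_sequentiallyI[of M]) (simp add: add.assoc)
  then show ?thesis
    by (rule filterlim_at_bot_mono[OF linear_at_bot[OF assms(1)]])
qed

text \<open>Eventually one real \<open>c\<close> lies below the objective on all of
  \<open>Sigma\<close> and \<open>B\<close>, while \<open>U n\<close> drops to \<open>c\<close> or
  less, so \<open>\<theta>0\<close> beats every element of \<open>Sigma\<close>. As \<open>U\<close>
  does not depend on \<open>f\<close>, one \<open>N\<close> serves all of \<open>B\<close>.\<close>

lemma minimisers_eventually_outside:
  fixes L :: "'p \<Rightarrow> 'f \<Rightarrow> nat \<Rightarrow> real" and Theta Sigma :: "'p set"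
  assumes "\<theta>0 \<in> Theta"
    and lower: "liminf (\<lambda>n. INF \<theta>\<in>Sigma. INF f\<in>B. ereal (L \<theta> f n)) > -\<infinity>"
    and upper: "filterlim U at_bot sequentially"
      "\<forall>\<^sub>F n in sequentially. \<forall>f\<in>B. L \<theta>0 f n \<le> U n"
  shows "\<exists>N. \<forall>f\<in>B. \<forall>n\<ge>N. \<forall>\<theta>. is_arg_min (\<lambda>\<theta>. L \<theta> f n) (\<lambda>\<theta>. \<theta> \<in> Theta) \<theta> \<longrightarrow> \<theta> \<notin> Sigma"
proof -
  obtain c where "ereal c < liminf (\<lambda>n. INF \<theta>\<in>Sigma. INF f\<in>B. ereal (L \<theta> f n))"
    using ereal_dense2[OF lower] by blast
  from less_LiminfD[OF this]
  have "\<forall>\<^sub>F n in sequentially. ereal c < (INF \<theta>\<in>Sigma. INF f\<in>B. ereal (L \<theta> f n))" .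
  moreover have "\<forall>\<^sub>F n in sequentially. U n \<le> c"
    using upper(1) by (simp add: filterlim_at_bot)
  ultimately have "\<forall>\<^sub>F n in sequentially. \<forall>f\<in>B. \<forall>\<theta>\<in>Sigma. L \<theta>0 f n < L \<theta> f n"
    using upper(2)
  proof eventually_elim
    case (elim n)
    have "c < L \<theta> f n" if "f \<in> B" "\<theta> \<in> Sigma" for f \<theta>
    proof -
      have "(INF \<theta>\<in>Sigma. INF f\<in>B. ereal (L \<theta> f n)) \<le> ereal (L \<theta> f n)"
        using that by (intro INF_lower2[OF that(2)] INF_lower)
      with elim(1) have "ereal c < ereal (L \<theta> f n)" by (rule less_le_trans)
      then show ?thesis by simp
    qed
    with elim(2,3) show ?case by force
  qed
  then show ?thesis
    using assms(1) by (fastforce simp: eventually_sequentially is_arg_min_linorder)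
qed

theorem theorem2p5:
  fixes Omega :: "'a set"
    and Theta Sigma :: "'p set"
    and K :: "'p \<Rightarrow> 'a \<Rightarrow> 'a \<Rightarrow> real"
    and x :: "nat \<Rightarrow> 'a"
    and \<theta>B :: 'p
    and H B :: "('a \<Rightarrow> real) set"
    and ip :: "('a \<Rightarrow> real) \<Rightarrow> ('a \<Rightarrow> real) \<Rightarrow> real"
  assumes "infinite Omega"
    and "\<And>\<theta>. \<theta> \<in> Theta \<Longrightarrow> spd_kernel Omega (K \<theta>)"
    and "x ` {1..} \<subseteq> Omega"
    and "inj_on x {1..}"
    and "Sigma \<subseteq> Theta"
    and "\<theta>B \<in> Theta"
    and "rkhs Omega (K \<theta>B) H ip"
    and "B \<subseteq> H"
    and "bdd_above (fun_norm ip ` B)"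
  shows
    "(limsup (\<lambda>n. ereal (cond_var (K \<theta>B) (x n) (pts x (n - 1)))) < 1 \<and>
      liminf (\<lambda>n. INF \<theta>\<in>Sigma. INF f\<in>B. ereal (ell_ML (K \<theta>) f x n)) > -\<infinity> \<longrightarrow>
      (\<exists>N. \<forall>f\<in>B. \<forall>n\<ge>N. \<forall>\<theta>. is_ML_estimate Theta K f x n \<theta> \<longrightarrow> \<theta> \<notin> Sigma))
     \<and>
     (limsup (\<lambda>n. ereal (MAX i\<in>{1..n}. cond_var (K \<theta>B) (x i) (pts_del x n i)))
        < ereal (exp (- (SUP f\<in>B. fun_norm ip f)\<^sup>2)) \<and>
      liminf (\<lambda>n. INF \<theta>\<in>Sigma. INF f\<in>B. ereal (ell_CV (K \<theta>) f x n)) > -\<infinity> \<longrightarrow>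
      (\<exists>N. \<forall>f\<in>B. \<forall>n\<ge>N. \<forall>\<theta>. is_CV_estimate Theta K f x n \<theta> \<longrightarrow> \<theta> \<notin> Sigma))"
proof -
  interpret rkhs Omega "K \<theta>B" H ip by fact
  note spd = assms(2)[OF assms(6)] and x = assms(3,4)
  define b where "b = (SUP f\<in>B. fun_norm ip f)"
  have ip_le: "ip f f \<le> b\<^sup>2" if "f \<in> B" for f
  proof -
    have nonneg: "0 \<le> ip f f" using ip_nonneg that assms(8) by blast
    have "sqrt (ip f f) \<le> b"
      using cSUP_upper[OF that assms(9)] by (simp add: b_def fun_norm_def)
    with nonneg have "(sqrt (ip f f))\<^sup>2 \<le> b\<^sup>2" by (intro power_mono) auto
    with nonneg show ?thesis by simp
  qed
  have ml: "\<exists>N. \<forall>f\<in>B. \<forall>n\<ge>N. \<forall>\<theta>. is_ML_estimate Theta K f x n \<theta> \<longrightarrow> \<theta> \<notin> Sigma"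
    if lim: "limsup (\<lambda>n. ereal (cond_var (K \<theta>B) (x n) (pts x (n - 1)))) < 1"
      and low: "liminf (\<lambda>n. INF \<theta>\<in>Sigma. INF f\<in>B. ereal (ell_ML (K \<theta>) f x n)) > -\<infinity>"
  proof -
    let ?v = "\<lambda>n. cond_var (K \<theta>B) (x n) (pts x (n - 1))"
    obtain c where c: "c < 1" and ev: "\<forall>\<^sub>F n in sequentially. ?v n < c"
      by (rule limsup_ereal_less_eventually[of ?v 1]) (use lim in \<open>auto simp: one_ereal_def\<close>)
    \<comment> \<open>At \<open>n = 0\<close> the variance involves the arbitrary value
      \<open>x 0\<close>, so positivity is used only from 1 on.\<close>
    have ev': "\<forall>\<^sub>F n in sequentially. 0 < ?v n \<and> ?v n < c"
      using ev eventually_ge_at_top[of 1]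
      by eventually_elim (use cond_var_pts_pos[OF spd x] in auto)
    \<comment> \<open>Some positive variance lies below \<open>c\<close>. Only with
      \<open>0 < c\<close> does \<open>c < 1\<close> give a negative logarithm.\<close>
    then have "0 < c" by (auto simp: eventually_sequentially dest: less_trans)
    with c have "ln c < 0" by simp
    moreover have "\<forall>\<^sub>F n in sequentially. ln (?v n) \<le> ln c"
      using ev' by eventually_elim auto
    ultimately have "filterlim (\<lambda>n. b\<^sup>2 + (\<Sum>i=1..n. ln (?v i))) at_bot sequentially"
      by (rule sum_at_bot)
    moreover have "ell_ML (K \<theta>B) f x n \<le> b\<^sup>2 + (\<Sum>i=1..n. ln (?v i))" if "f \<in> B" for f n
      using ell_ML_le[OF spd x, of f n] ip_le[OF that] that assms(8) by fastforce
    ultimately show ?thesis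
      unfolding is_ML_estimate_def
      by (intro minimisers_eventually_outside[OF assms(6) low]) auto
  qed
  have cv: "\<exists>N. \<forall>f\<in>B. \<forall>n\<ge>N. \<forall>\<theta>. is_CV_estimate Theta K f x n \<theta> \<longrightarrow> \<theta> \<notin> Sigma"
    if lim: "limsup (\<lambda>n. ereal (MAX i\<in>{1..n}. cond_var (K \<theta>B) (x i) (pts_del x n i)))
        < ereal (exp (- b\<^sup>2))"
      and low: "liminf (\<lambda>n. INF \<theta>\<in>Sigma. INF f\<in>B. ereal (ell_CV (K \<theta>) f x n)) > -\<infinity>"
  proof -
    let ?v = "\<lambda>n i. cond_var (K \<theta>B) (x i) (pts_del x n i)"
    note pos = cond_var_pts_del_pos[OF spd x]
    obtain c where c: "c < exp (- b\<^sup>2)"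
      and ev: "\<forall>\<^sub>F n in sequentially. (MAX i\<in>{1..n}. ?v n i) < c"
      by (rule limsup_ereal_less_eventually[OF lim])
    \<comment> \<open>From \<open>n = 1\<close> on the index set is nonempty, so a bound on the
      maximum bounds every variance.\<close>
    have ev': "\<forall>\<^sub>F n in sequentially. \<forall>i\<in>{1..n}. ?v n i < c"
      using ev eventually_ge_at_top[of 1]
      by eventually_elim (subst (asm) Max_less_iff; auto)
    obtain n where "1 \<le> n" "?v n 1 < c"
      using eventually_happens[OF eventually_conj[OF ev' eventually_ge_at_top[of 1]]] by auto
    then have "0 < c" using pos[of 1 n] by linarith
    \<comment> \<open>The threshold \<open>exp (- b\<^sup>2)\<close> is exactly what makes this
      slope negative.\<close>
    with c have "b\<^sup>2 + ln c < 0"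
      using ln_less_cancel_iff[of c "exp (- b\<^sup>2)"] by simp
    \<comment> \<open>Leave-one-out variances change with \<open>n\<close>, so these are not partial
      sums of one fixed sequence; a common bound on all \<open>n\<close> summands gives a linear
      bound instead.\<close>
    then have "filterlim (\<lambda>n::nat. 0 + real n * (b\<^sup>2 + ln c)) at_bot sequentially"
      by (rule linear_at_bot)
    moreover have "\<forall>\<^sub>F n in sequentially. \<forall>f\<in>B. ell_CV (K \<theta>B) f x n \<le> 0 + real n * (b\<^sup>2 + ln c)"
      using ev'
    proof eventually_elim
      case (elim n)
      show ?case
      proof
        fix f assume f: "f \<in> B"
        have "ell_CV (K \<theta>B) f x n \<le> (\<Sum>i=1..n. ip f f + ln (?v n i))"
          using f assms(8) by (intro ell_CV_le[OF spd x]) auto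
        also have "\<dots> \<le> (\<Sum>i=1..n. b\<^sup>2 + ln c)"
        proof (intro sum_mono add_mono ip_le[OF f])
          fix i assume "i \<in> {1..n}"
          then have "0 < ?v n i" "?v n i < c" using elim pos[of i n] by auto
          then show "ln (?v n i) \<le> ln c" by simp
        qed
        finally show "ell_CV (K \<theta>B) f x n \<le> 0 + real n * (b\<^sup>2 + ln c)" by simp
      qed
    qed
    ultimately show ?thesis
      unfolding is_CV_estimate_def
      by (intro minimisers_eventually_outside[OF assms(6) low])
  qed
  show ?thesis
    unfolding b_def[symmetric] by (rule conjI; rule impI; elim conjE; rule ml cv; assumption)
qed

end
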